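(* If there exists a matrix $\bar D\in\{0,1\}^{K\times m}$ that is a bi-adjacency matrix of the type defined in the context and that has an all-one submatrix whose rows and columns correspond to $\bar{\mathcal S}$ and $\bar{\mathcal A}$, respectively, where $\bar{\mathcal S}\subseteq\mathcal K$, $|\bar{\mathcal S}|\ge\theta K$ and $\bar{\mathcal A}\subseteq\mathcal I$, then there exists a solution $(\bar c,\{\bar\epsilon^k\}_{k\in\mathcal K},\bar y,\bar{\mathcal S})$ feasible for $\mathbf{QIO}(\mathcal K,\tau,\theta)$ with $\bar c\in\mathrm{cone}(\{a^i\}_{i\in\bar{\mathcal A}})$.
   Context: Setting: $A\in\mathbb R^{m\times n}$, $b\in\mathbb R^m$, $\mathcal I=\{1,\dots,m\}$; $a^i\in\mathbb R^n$ is the $i$-th row of $A$ written as a column vector; prime denotes transpose. The forward feasible region $\mathcal X=\{x\in\mathbb R^n: Ax\ge b\}$ is bounded, full-dimensional and free of redundant constraints. Norm parameters $\ell,p\ge1$ (possibly $\infty$) are fixed, and $\|a^i\|_p=1$ for all $i$. The dataset $\{\hat x^1,\dots,\hat x^K\}\subset\mathbb R^n$ is indexed by $\mathcal K=\{1,\dots,K\}$, with no assumption on feasibility or optimality of the points. $\tau\ge0$ and $\theta\in[0,1]$. $\mathrm{cone}(\cdot)$ is the set of conic (nonnegative linear) combinations of the given vectors. Quantile inverse optimization problem $\mathbf{QIO}(\mathcal K,\tau,\theta)$: find $c\in\mathbb R^n$, $\{\epsilon^k\}_{k\in\mathcal K}\subset\mathbb R^n$, $y\in\mathbb R^m$, $\mathcal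 S\subseteq\mathcal K$ such that $A'y=c$, $y\ge0$; $A(\hat x^k-\epsilon^k)\ge b$, $c'(\hat x^k-\epsilon^k)=b'y$ and $\|\epsilon^k\|_\ell\le\tau$ for all $k\in\mathcal S$; $|\mathcal S|\ge\theta K$; and $\|c\|_p=1$. Single-point system with respect to $\hat x^k$, in $v\in\{0,1\}^m$, $\epsilon\in\mathbb R^n$: $b_i\le{a^i}'(\hat x^k-\epsilon)\le b_i+M(1-v_i)$ for all $i\in\mathcal I$, and $\|\epsilon\|_\ell\le\tau$, where $M$ is a sufficiently large constant ($M\ge\max_{i\in\mathcal I,x\in\mathcal X}({a^i}'x-b_i)$). Bi-adjacency matrix $\bar D$: for each $k\in\mathcal K$ choose a $v^k$ that is the $v$-part of some feasible solution of the single-point system with respect to $\hat x^k$; the bipartite graph has nodes $V_1=\mathcal K$, $V_2=\mathcal I$ and an edge $(k,i)$ iff $v^k_i=1$; $\bar D_{ki}=1$ if $(k,i)$ is an edge and $0$ otherwise (i.e. the $k$-th row of $\bar D$ is ${v^k}'$). Different choices of the $v^k$ give different matrices $\bar D$. A submatrix has at least one row and one column. *)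

theory Defs
  imports "HOL-Analysis.Analysis"
begin

text \<open>
  The finite types \<open>'m\<close>, \<open>'n\<close> and \<open>'k\<close> index the constraints, the coordinates and the data points;
  the rows \<open>row i A\<close> are the vectors \<open>a\<^sup>i\<close>. Vector inequalities on \<open>real ^ 'm\<close> are componentwise.
\<close>

definition lp_norm :: "ereal \<Rightarrow> real ^ 'n \<Rightarrow> real" where
  "lp_norm p x =
     (if p = \<infinity> then infnorm x
      else (\<Sum>j\<in>UNIV. \<bar>x $ j\<bar> powr real_of_ereal p) powr (1 / real_of_ereal p))"

definition feasible_region :: "real ^ 'n ^ 'm \<Rightarrow> real ^ 'm \<Rightarrow> (real ^ 'n) set" where
  "feasible_region A b = {x. A *v x \<ge> b}"

definition redundant_constraint :: "real ^ 'n ^ 'm \<Rightarrow> real ^ 'm \<Rightarrow> 'm \<Rightarrow> bool" where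
  "redundant_constraint A b i \<longleftrightarrow>
     {x. \<forall>j. j \<noteq> i \<longrightarrow> row j A \<bullet> x \<ge> b $ j} = feasible_region A b"

definition conic_combinations :: "'a::real_vector set \<Rightarrow> 'a set" where
  "conic_combinations V =
     {\<Sum>w\<in>T. u w *\<^sub>R w | T u. finite T \<and> T \<subseteq> V \<and> (\<forall>w\<in>T. 0 \<le> u w)}"

lemma conic_combinations_eq_hull: "conic_combinations V = convex_cone hull V"
proof
  have "(\<Sum>w\<in>T. u w *\<^sub>R w) \<in> convex_cone hull V"
    if "finite T" "T \<subseteq> V" "\<forall>w\<in>T. 0 \<le> u w" for T u
    using that
    by (induction T rule: finite_induct)
       (simp_all add: convex_cone_hull_contains_0 convex_cone_hull_add convex_cone_hull_mul hull_inc)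
  then show "conic_combinations V \<subseteq> convex_cone hull V"
    by (auto simp: conic_combinations_def)
next
  have inc: "V \<subseteq> conic_combinations V"
  proof
    fix x assume "x \<in> V"
    then show "x \<in> conic_combinations V"
      unfolding conic_combinations_def
      by (intro CollectI exI[of _ "{x}"] exI[of _ "\<lambda>_. 1"]) auto
  qed
  have zero: "0 \<in> conic_combinations V"
    unfolding conic_combinations_def
    by (intro CollectI exI[of _ "{}"] exI[of _ "\<lambda>_. 1"]) auto
  have add: "x + y \<in> conic_combinations V"
    if x: "x \<in> conic_combinations V" and y: "y \<in> conic_combinations V" for x y
  proof -
    obtain S s where S: "finite S" "S \<subseteq> V" "\<forall>w\<in>S. 0 \<le> s w" "x = (\<Sum>w\<in>S. s w *\<^sub>R w)"
      using x by (auto simp: conic_combinations_def)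
    obtain T t where T: "finite T" "T \<subseteq> V" "\<forall>w\<in>T. 0 \<le> t w" "y = (\<Sum>w\<in>T. t w *\<^sub>R w)"
      using y by (auto simp: conic_combinations_def)
    let ?s = "\<lambda>w. if w \<in> S then s w else 0" and ?t = "\<lambda>w. if w \<in> T then t w else 0"
    have "x = (\<Sum>w\<in>S \<union> T. ?s w *\<^sub>R w)"
      unfolding S(4) using S(1) T(1) by (intro sum.mono_neutral_cong_left) auto
    moreover have "y = (\<Sum>w\<in>S \<union> T. ?t w *\<^sub>R w)"
      unfolding T(4) using S(1) T(1) by (intro sum.mono_neutral_cong_left) auto
    ultimately have "x + y = (\<Sum>w\<in>S \<union> T. (?s w + ?t w) *\<^sub>R w)"
      by (simp only: scaleR_add_left sum.distrib)
    then show ?thesis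
      unfolding conic_combinations_def using S T
      by (intro CollectI exI[of _ "S \<union> T"] exI[of _ "\<lambda>w. ?s w + ?t w"]) auto
  qed
  have scale: "r *\<^sub>R x \<in> conic_combinations V"
    if x: "x \<in> conic_combinations V" and r: "0 \<le> r" for x r
  proof -
    obtain S s where S: "finite S" "S \<subseteq> V" "\<forall>w\<in>S. 0 \<le> s w" "x = (\<Sum>w\<in>S. s w *\<^sub>R w)"
      using x by (auto simp: conic_combinations_def)
    then show ?thesis
      unfolding conic_combinations_def using r
      by (intro CollectI exI[of _ S] exI[of _ "\<lambda>w. r * s w"]) (auto simp: scaleR_sum_right)
  qed
  have "convex_cone (conic_combinations V)"
    unfolding convex_cone_iff using zero add scale by auto
  then show "convex_cone hull V \<subseteq> conic_combinations V"
    using inc by (intro hull_minimal)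
qed

definition QIO_feasible ::
  "real ^ 'n ^ 'm \<Rightarrow> real ^ 'm \<Rightarrow> ereal \<Rightarrow> ereal \<Rightarrow> ('k::finite \<Rightarrow> real ^ 'n) \<Rightarrow> real \<Rightarrow> real
    \<Rightarrow> real ^ 'n \<Rightarrow> ('k \<Rightarrow> real ^ 'n) \<Rightarrow> real ^ 'm \<Rightarrow> 'k set \<Rightarrow> bool" where
  "QIO_feasible A b l p xhat \<tau> \<theta> c \<epsilon> y S \<longleftrightarrow>
     transpose A *v y = c \<and> y \<ge> 0 \<and>
     (\<forall>k\<in>S. A *v (xhat k - \<epsilon> k) \<ge> b \<and> c \<bullet> (xhat k - \<epsilon> k) = b \<bullet> y \<and> lp_norm l (\<epsilon> k) \<le> \<tau>) \<and>
     real (card S) \<ge> \<theta> * real CARD('k) \<and>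
     lp_norm p c = 1"

definition single_point_feasible ::
  "real ^ 'n ^ 'm \<Rightarrow> real ^ 'm \<Rightarrow> real \<Rightarrow> ereal \<Rightarrow> real \<Rightarrow> real ^ 'n
    \<Rightarrow> real ^ 'm \<Rightarrow> real ^ 'n \<Rightarrow> bool" where
  "single_point_feasible A b M l \<tau> x v \<epsilon> \<longleftrightarrow>
     (\<forall>i. v $ i \<in> {0, 1}) \<and>
     (\<forall>i. b $ i \<le> row i A \<bullet> (x - \<epsilon>) \<and> row i A \<bullet> (x - \<epsilon>) \<le> b $ i + M * (1 - v $ i)) \<and>
     lp_norm l \<epsilon> \<le> \<tau>"

definition bipartite_edges :: "('k \<Rightarrow> real ^ 'm) \<Rightarrow> ('k \<times> 'm) set" where
  "bipartite_edges v = {(k, i). v k $ i = 1}"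

definition adjacency_of_edges :: "('k \<times> 'm) set \<Rightarrow> real ^ 'm ^ 'k" where
  "adjacency_of_edges E = (\<chi> k i. if (k, i) \<in> E then 1 else 0)"

definition bi_adjacency_matrix ::
  "real ^ 'n ^ 'm \<Rightarrow> real ^ 'm \<Rightarrow> real \<Rightarrow> ereal \<Rightarrow> real \<Rightarrow> ('k \<Rightarrow> real ^ 'n)
    \<Rightarrow> real ^ 'm ^ 'k \<Rightarrow> bool" where
  "bi_adjacency_matrix A b M l \<tau> xhat D \<longleftrightarrow>
     (\<exists>v. (\<forall>k. \<exists>\<epsilon>. single_point_feasible A b M l \<tau> (xhat k) (v k) \<epsilon>) \<and>
          D = adjacency_of_edges (bipartite_edges v))"

definition all_one_submatrix :: "real ^ 'm ^ 'k \<Rightarrow> 'k set \<Rightarrow> 'm set \<Rightarrow> bool" where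
  "all_one_submatrix D R C \<longleftrightarrow> R \<noteq> {} \<and> C \<noteq> {} \<and> (\<forall>k\<in>R. \<forall>i\<in>C. D $ k $ i = 1)"

end

theory Submission
  imports Defs
begin

text \<open>A single column \<open>i\<close> of the all-one block already yields a solution: take
  the cost vector \<open>row i A\<close> with dual multiplier the unit vector
  \<open>axis i 1\<close>, and for the perturbations the \<epsilon>-parts of the single-point
  solutions behind the matrix. Dual feasibility is immediate and the normalization of the rows gives
  norm 1. Since \<open>b \<bullet> axis i 1 = b $ i\<close>, strong duality at a point of
  \<open>S\<close> says exactly that constraint \<open>i\<close> is tight at the perturbed point; an
  entry 1 in column \<open>i\<close> forces this, and the same \<open>i\<close> serves every
  \<open>k\<close> in \<open>S\<close>.\<close>

theorem proposition7:
  fixes A :: "real ^ 'n ^ 'm" and b :: "real ^ 'm"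
    and xhat :: "'k::finite \<Rightarrow> real ^ 'n"
    and l p :: ereal and \<tau> \<theta> M :: real
    and S :: "'k set" and Act :: "'m set"
  assumes "bounded (feasible_region A b)"
    and "aff_dim (feasible_region A b) = int CARD('n)"
    and "\<And>i. \<not> redundant_constraint A b i"
    and "1 \<le> l" and "1 \<le> p"
    and "\<And>i. lp_norm p (row i A) = 1"
    and "0 \<le> \<tau>" and "0 \<le> \<theta>" and "\<theta> \<le> 1"
    and "\<And>i x. x \<in> feasible_region A b \<Longrightarrow> row i A \<bullet> x - b $ i \<le> M"
    and "real (card S) \<ge> \<theta> * real CARD('k)"
    and "\<exists>D. bi_adjacency_matrix A b M l \<tau> xhat D \<and> all_one_submatrix D S Act"
  shows "\<exists>c \<epsilon> y. QIO_feasible A b l p xhat \<tau> \<theta> c \<epsilon> y S \<and>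
                 c \<in> conic_combinations {row i A | i. i \<in> Act}"
proof -
  obtain v where feas: "\<forall>k. \<exists>\<epsilon>. single_point_feasible A b M l \<tau> (xhat k) (v k) \<epsilon>"
    and ones: "all_one_submatrix (adjacency_of_edges (bipartite_edges v)) S Act"
    using assms(12) by (auto simp: bi_adjacency_matrix_def)
  obtain \<epsilon> where \<epsilon>: "\<And>k. single_point_feasible A b M l \<tau> (xhat k) (v k) (\<epsilon> k)"
    using feas by metis
  obtain i where i: "i \<in> Act"
    using ones by (auto simp: all_one_submatrix_def)
  have active: "v k $ i = 1" if "k \<in> S" for k
    using ones i that
    by (auto simp: all_one_submatrix_def adjacency_of_edges_def bipartite_edges_def split: if_splits)
  \<comment> \<open>With \<open>v k $ i = 1\<close> the big-M term \<open>M * (1 - v k $ i)\<close>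
    vanishes, so the upper and lower bounds on constraint \<open>i\<close> coincide, whatever the
    value of \<open>M\<close>.\<close>
  have tight: "row i A \<bullet> (xhat k - \<epsilon> k) = b $ i" if "k \<in> S" for k
    using \<epsilon>[of k] active[OF that]
    by (auto simp: single_point_feasible_def intro!: antisym dest: spec[where x = i])
  have feasible: "A *v (xhat k - \<epsilon> k) \<ge> b" for k
    using \<epsilon>[of k]
    by (simp add: single_point_feasible_def less_eq_vec_def matrix_vector_mul_component row_def)
  have "0 \<le> (axis i 1 :: real ^ 'm)"
    by (simp add: less_eq_vec_def axis_def)
  moreover have "transpose A *v axis i 1 = row i A"
    by (simp add: matrix_vector_mult_basis)
  \<comment> \<open>By \<open>inner_axis\<close> the dual objective collapses to
    \<open>b $ i\<close>, so \<open>tight\<close> is the duality equation.\<close>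
  ultimately have "QIO_feasible A b l p xhat \<tau> \<theta> (row i A) \<epsilon> (axis i 1) S"
    using assms(6,11) \<epsilon> tight feasible
    by (auto simp: QIO_feasible_def single_point_feasible_def inner_axis)
  \<comment> \<open>Seen as a hull, the cone contains each of its generators.\<close>
  moreover have "row i A \<in> conic_combinations {row i A | i. i \<in> Act}"
    unfolding conic_combinations_eq_hull using i by (auto intro: hull_inc)
  ultimately show ?thesis
    by blast
qed

end
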